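(* There is a constant $C$ such that the following holds. Let $\delta>0$, let $u,\tilde u\in\mathcal{H}^3_0[a,b]$ satisfy $\|u-\tilde u\|_{\mathcal{H}^1}\le\delta$, and let $\varphi,\tilde\varphi\in\mathcal{L}^2[a,b]$ denote their respective recovered functions, i.e. $T_D\varphi=-u''$ and $T_D\tilde\varphi=-\tilde u''$. Let the functional $G$ be defined based on $\tilde u$, that is, $G(\psi)=\|u_\psi'-\tilde u'\|_{\mathcal{L}^2}^2$ for $\psi\in\mathcal{L}^2[a,b]$ (so that $G(\tilde\varphi)=0$). Then $$0\le G(\varphi)\le C\delta^2 .$$
   Context: All functions are real-valued on a bounded closed interval $[a,b]\subset\mathbb{R}$, $a<b$. $\mathcal{H}^q[a,b]$ is the usual Sobolev space of functions $f$ with $f,f',\dots,f^{(q)}\in\mathcal{L}^2[a,b]$, with $\|f\|_{\mathcal{H}^1}^2=\|f\|_{\mathcal{L}^2}^2+\|f'\|_{\mathcal{L}^2}^2$. $\mathcal{H}^q_0[a,b]$ denotes the set of $f\in\mathcal{H}^q[a,b]$ with $f(a)=f(b)=0$ (only the function values vanish, not the derivatives). The operator $T_D:\mathcal{L}^2[a,b]\to\mathcal{L}^2[a,b]$ is $(T_D\psi)(x)=\int_a^x\psi(\xi)\,d\xi$. For $\psi\in\mathcal{L}^2[a,b]$, $u_\psi$ is the unique solution of $-u_\psi''=T_D\psi$ with $u_\psi(a)=u_\psi(b)=0$. *)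

theory Defs
  imports "HOL-Analysis.Analysis"
begin

text \<open>
  Elements of $L^2[a,b]$ and of the Sobolev spaces are represented by functions on the whole real
  line; only their restrictions to $[a,b]$ matter, and equality of $L^2$ functions is equality
  almost everywhere on $[a,b]$.
\<close>

definition L2 :: "real \<Rightarrow> real \<Rightarrow> (real \<Rightarrow> real) set" where
  "L2 a b = {f. f \<in> borel_measurable (lebesgue_on {a..b}) \<and>
                integrable (lebesgue_on {a..b}) (\<lambda>x. (f x)\<^sup>2)}"

definition L2_norm :: "real \<Rightarrow> real \<Rightarrow> (real \<Rightarrow> real) \<Rightarrow> real" where
  "L2_norm a b f = sqrt (LINT x|lebesgue_on {a..b}. (f x)\<^sup>2)"

text \<open>Test functions: $C_c^\infty$ functions on the open interval $(a,b)$, extended by zero.\<close>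

definition test_fun :: "real \<Rightarrow> real \<Rightarrow> (real \<Rightarrow> real) set" where
  "test_fun a b = {\<eta>. (\<forall>n x. (deriv ^^ n) \<eta> differentiable at x) \<and>
                      closure {x. \<eta> x \<noteq> 0} \<subseteq> {a<..<b}}"

definition has_weak_deriv ::
    "real \<Rightarrow> real \<Rightarrow> (real \<Rightarrow> real) \<Rightarrow> (real \<Rightarrow> real) \<Rightarrow> bool" where
  "has_weak_deriv a b f g \<longleftrightarrow>
     integrable (lebesgue_on {a..b}) f \<and> integrable (lebesgue_on {a..b}) g \<and>
     (\<forall>\<eta>\<in>test_fun a b. (LINT x|lebesgue_on {a..b}. f x * deriv \<eta> x) =
                        - (LINT x|lebesgue_on {a..b}. g x * \<eta> x))"

text \<open>A choice of representative: weak derivatives are unique up to null sets.\<close>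

definition weak_deriv :: "real \<Rightarrow> real \<Rightarrow> (real \<Rightarrow> real) \<Rightarrow> real \<Rightarrow> real" where
  "weak_deriv a b f = (SOME g. has_weak_deriv a b f g)"

text \<open>In the next definition \<open>D k\<close> plays the role of $f^{(k)}$.\<close>

definition sobolev :: "nat \<Rightarrow> real \<Rightarrow> real \<Rightarrow> (real \<Rightarrow> real) set" where
  "sobolev q a b = {f. \<exists>D. D 0 = f \<and> (\<forall>k\<le>q. D k \<in> L2 a b) \<and>
                           (\<forall>k<q. has_weak_deriv a b (D k) (D (Suc k)))}"

text \<open>
  Point values of a Sobolev function (of order at least one) are those of its continuous
  representative, hence the continuity requirement. Derivatives are not required to vanish at the
  end points, so this is not the closure of the test functions.
\<close>

definition sobolev0 :: "nat \<Rightarrow> real \<Rightarrow> real \<Rightarrow> (real \<Rightarrow> real) set" where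
  "sobolev0 q a b = {f \<in> sobolev q a b. continuous_on {a..b} f \<and> f a = 0 \<and> f b = 0}"

definition H1_norm :: "real \<Rightarrow> real \<Rightarrow> (real \<Rightarrow> real) \<Rightarrow> real" where
  "H1_norm a b f = sqrt ((L2_norm a b f)\<^sup>2 + (L2_norm a b (weak_deriv a b f))\<^sup>2)"

definition T_D :: "real \<Rightarrow> (real \<Rightarrow> real) \<Rightarrow> real \<Rightarrow> real" where
  "T_D a \<psi> x = (LINT \<xi>|lebesgue_on {a..x}. \<psi> \<xi>)"

text \<open>The equation $T_D\psi = -u''$ between elements of $L^2[a,b]$.\<close>

definition T_D_eq :: "real \<Rightarrow> real \<Rightarrow> (real \<Rightarrow> real) \<Rightarrow> (real \<Rightarrow> real) \<Rightarrow> bool" where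
  "T_D_eq a b \<psi> u \<longleftrightarrow>
     (AE x in lebesgue_on {a..b}. T_D a \<psi> x = - weak_deriv a b (weak_deriv a b u) x)"

text \<open>The solution is unique as a function on $[a,b]$; its values elsewhere are immaterial.\<close>

definition u_sol :: "real \<Rightarrow> real \<Rightarrow> (real \<Rightarrow> real) \<Rightarrow> real \<Rightarrow> real" where
  "u_sol a b \<psi> = (SOME u. u \<in> sobolev0 2 a b \<and> T_D_eq a b \<psi> u)"

definition G :: "real \<Rightarrow> real \<Rightarrow> (real \<Rightarrow> real) \<Rightarrow> (real \<Rightarrow> real) \<Rightarrow> real" where
  "G a b v \<psi> =
     (L2_norm a b (\<lambda>x. weak_deriv a b (u_sol a b \<psi>) x - weak_deriv a b v x))\<^sup>2"

end

theory Submission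
  imports Defs
begin

text \<open>
  Since $u$ itself solves the boundary value problem with right-hand side $T_D\varphi$, uniqueness
  of the solution gives $u_\varphi' = u'$ almost everywhere, so $G(\varphi)$ is
  $\|u' - \tilde u'\|_{L^2}^2 \le \|u - \tilde u\|_{H^1}^2$ and $C = 1$ works. The substance is
  that weak derivatives are unique almost everywhere and that a vanishing weak derivative forces a
  constant. Both rest on a supply of test functions, built from $e^{-1/x}$.
\<close>

subsection \<open>Test functions\<close>

text \<open>The polynomial in \<open>1 / x\<close> makes the family closed under differentiation;
  \<open>flat 1\<close> is the classical smooth function that is flat at 0.\<close>

definition flat :: "real poly \<Rightarrow> real \<Rightarrow> real" where
  "flat p x = (if x > 0 then poly p (1 / x) * exp (- (1 / x)) else 0)"

lemma tendsto_poly_times_exp_neg: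
  fixes p :: "real poly"
  shows "((\<lambda>t. poly p t * exp (- t)) \<longlongrightarrow> 0) at_top"
proof -
  have "((\<lambda>t. \<Sum>i\<le>degree p. coeff p i * (t ^ i / exp t)) \<longlongrightarrow> (\<Sum>i\<le>degree p. coeff p i * 0)) at_top"
    by (intro tendsto_intros tendsto_power_div_exp_0)
  moreover have "(\<lambda>t. \<Sum>i\<le>degree p. coeff p i * (t ^ i / exp t)) = (\<lambda>t. poly p t * exp (- t))"
    by (simp add: poly_altdef sum_distrib_right exp_minus divide_inverse mult.assoc)
  ultimately show ?thesis by simp
qed

lemma flat_tendsto_0: "(flat p \<longlongrightarrow> 0) (at_right 0)"
proof -
  have "((\<lambda>x. poly p (inverse x) * exp (- inverse x)) \<longlongrightarrow> 0) (at_right 0)"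
    by (rule filterlim_compose[OF tendsto_poly_times_exp_neg filterlim_inverse_at_top_right])
  then show ?thesis
    by (rule Lim_transform_eventually)
       (auto simp: flat_def eventually_at_right_less inverse_eq_divide
         intro!: eventually_mono[OF eventually_at_right_less])
qed

text \<open>Chain rule for \<open>poly p t * exp (- t)\<close> at \<open>t = 1 / x\<close>: the
  inner derivative is \<open>- t^2\<close>, hence the factor \<open>[:0, 0, 1:]\<close>.\<close>

definition flat_deriv :: "real poly \<Rightarrow> real poly" where
  "flat_deriv p = [:0, 0, 1:] * (p - pderiv p)"

lemma flat_has_derivative: "(flat p has_real_derivative flat (flat_deriv p) x) (at x)"
proof -
  consider "x > 0" | "x < 0" | "x = 0" by linarith
  then show ?thesis
  proof cases
    case 1
    have "((\<lambda>x. poly p (1 / x) * exp (- (1 / x))) has_real_derivative flat (flat_deriv p) x) (at x)"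
      using 1
      by (auto intro!: derivative_eq_intros DERIV_chain'[where g = "poly p"] poly_DERIV
          simp: flat_def flat_deriv_def field_simps power2_eq_square)
    then show ?thesis
      by (rule has_field_derivative_transform_within_open[where S = "{0<..}"])
         (use 1 in \<open>auto simp: flat_def\<close>)
  next
    case 2
    have "((\<lambda>x. 0) has_real_derivative flat (flat_deriv p) x) (at x)"
      using 2 by (auto simp: flat_def)
    then show ?thesis
      by (rule has_field_derivative_transform_within_open[where S = "{..<0}"])
         (use 2 in \<open>auto simp: flat_def\<close>)
  next
    case 3
    have "((\<lambda>y. (flat p y - flat p 0) / (y - 0)) \<longlongrightarrow> 0) (at_left 0)"
      by (rule Lim_transform_eventually[OF tendsto_const])
         (auto simp: flat_def eventually_at_filter)
    \<comment> \<open>To the right of 0 the difference quotient is \<open>flat (pCons 0 p)\<close>: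
      dividing by \<open>y\<close> multiplies the polynomial by its variable.\<close>
    moreover have "((\<lambda>y. (flat p y - flat p 0) / (y - 0)) \<longlongrightarrow> 0) (at_right 0)"
      by (rule Lim_transform_eventually[OF flat_tendsto_0[of "pCons 0 p"]])
         (auto simp: flat_def intro!: eventually_mono[OF eventually_at_right_less])
    ultimately have "((\<lambda>y. (flat p y - flat p 0) / (y - 0)) \<longlongrightarrow> 0) (at 0)"
      by (simp add: filterlim_at_split)
    then show ?thesis
      using 3 by (simp add: has_field_derivative_iff flat_def)
  qed
qed

text \<open>Closed under differentiation, which makes all its members smooth.\<close>

inductive_set flat_algebra :: "(real \<Rightarrow> real) set" where
  base: "(\<lambda>x. flat p (s * x + t)) \<in> flat_algebra"
| add: "f \<in> flat_algebra \<Longrightarrow> g \<in> flat_algebra \<Longrightarrow> (\<lambda>x. f x + g x) \<in> flat_algebra"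
| mult: "f \<in> flat_algebra \<Longrightarrow> g \<in> flat_algebra \<Longrightarrow> (\<lambda>x. f x * g x) \<in> flat_algebra"

lemma flat_algebra_deriv:
  assumes "f \<in> flat_algebra"
  shows "\<exists>g\<in>flat_algebra. \<forall>x. (f has_real_derivative g x) (at x)"
  using assms
proof induction
  case (base p s t)
  \<comment> \<open>The chain rule factor \<open>s\<close> is absorbed into the polynomial, so the
    derivative is again of the base form.\<close>
  have "((\<lambda>x. flat p (s * x + t)) has_real_derivative flat (smult s (flat_deriv p)) (s * x + t)) (at x)" for x
  proof -
    have "((\<lambda>x. flat p (s * x + t)) has_real_derivative flat (flat_deriv p) (s * x + t) * s) (at x)"
      by (rule DERIV_chain2[OF flat_has_derivative]) (auto intro!: derivative_eq_intros)
    then show ?thesis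
      by (simp add: flat_def mult_ac split: if_splits)
  qed
  then show ?case
    by (intro bexI[of _ "\<lambda>x. flat (smult s (flat_deriv p)) (s * x + t)"]) (auto intro: flat_algebra.base)
next
  case (add f g)
  then obtain f' g' where "f' \<in> flat_algebra" "\<forall>x. (f has_real_derivative f' x) (at x)"
    "g' \<in> flat_algebra" "\<forall>x. (g has_real_derivative g' x) (at x)" by blast
  then show ?case
    by (intro bexI[of _ "\<lambda>x. f' x + g' x"]) (auto intro: flat_algebra.intros DERIV_add)
next
  case (mult f g)
  then obtain f' g' where "f' \<in> flat_algebra" "\<forall>x. (f has_real_derivative f' x) (at x)"
    "g' \<in> flat_algebra" "\<forall>x. (g has_real_derivative g' x) (at x)" by blast
  then show ?case
    using mult.hyps
    by (intro bexI[of _ "\<lambda>x. f x * g' x + f' x * g x"])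
       (auto intro!: flat_algebra.intros derivative_eq_intros)
qed

lemma flat_algebra_smooth:
  assumes "f \<in> flat_algebra"
  shows "(deriv ^^ n) f differentiable at x"
proof -
  have deriv_mem: "deriv g \<in> flat_algebra" if g: "g \<in> flat_algebra" for g
  proof -
    obtain h where h: "h \<in> flat_algebra" "\<forall>x. (g has_real_derivative h x) (at x)"
      using flat_algebra_deriv[OF g] by blast
    then have "deriv g = h" by (auto intro: DERIV_imp_deriv)
    then show ?thesis using h by simp
  qed
  have "(deriv ^^ n) f \<in> flat_algebra"
    by (induction n) (auto intro: assms deriv_mem)
  then obtain g where "((deriv ^^ n) f has_real_derivative g x) (at x)"
    using flat_algebra_deriv by blast
  then show ?thesis
    by (rule differentiableI[OF has_field_derivative_imp_has_derivative])
qed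

text \<open>
  Supported in $[c + 1/n, d - 1/n]$ and increasing to the indicator function of $(c, d)$.
\<close>

definition plateau :: "real \<Rightarrow> real \<Rightarrow> nat \<Rightarrow> real \<Rightarrow> real" where
  "plateau c d n x = flat 1 (real n * (x - c) - 1) * flat 1 (real n * (d - x) - 1)"

lemma plateau_in_flat_algebra: "plateau c d n \<in> flat_algebra"
proof -
  have "plateau c d n = (\<lambda>x. flat 1 (real n * x + (- real n * c - 1)) * flat 1 ((- real n) * x + (real n * d - 1)))"
    by (auto simp: plateau_def algebra_simps)
  then show ?thesis by (simp only:) (intro flat_algebra.intros)
qed

lemma flat_1_bounds: "0 \<le> flat 1 x" "flat 1 x \<le> 1"
  by (auto simp: flat_def)

lemma plateau_bounds: "0 \<le> plateau c d n x" "plateau c d n x \<le> 1"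
  unfolding plateau_def using flat_1_bounds by (auto intro: mult_le_one)

lemma plateau_in_test_fun:
  assumes "a \<le> c" "d \<le> b"
  shows "plateau c d n \<in> test_fun a b"
proof -
  have "closure {x. plateau c d n x \<noteq> 0} \<subseteq> {a<..<b}"
  proof (cases "n = 0")
    \<comment> \<open>With \<open>1 / 0 = 0\<close> the bound used below would only give
      \<open>{c..d}\<close>; but here both arguments of \<open>flat 1\<close> are -1 and the
      function is 0.\<close>
    case True
    then show ?thesis by (simp add: plateau_def flat_def)
  next
    case False
    then have n: "real n > 0" by simp
    have "{x. plateau c d n x \<noteq> 0} \<subseteq> {c + 1 / n..d - 1 / n}"
      using n by (auto simp: plateau_def flat_def field_simps split: if_splits)
    then have "closure {x. plateau c d n x \<noteq> 0} \<subseteq> {c + 1 / n..d - 1 / n}"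
      by (simp add: closure_minimal)
    also have "\<dots> \<subseteq> {a<..<b}"
    proof
      fix x assume "x \<in> {c + 1 / n..d - 1 / n}"
      moreover have "1 / real n > 0" using n by simp
      ultimately show "x \<in> {a<..<b}" using assms by (simp only: atLeastAtMost_iff greaterThanLessThan_iff) linarith
    qed
    finally show ?thesis .
  qed
  then show ?thesis
    by (auto simp: test_fun_def flat_algebra_smooth plateau_in_flat_algebra)
qed

lemma flat_1_tendsto_1: "(flat 1 \<longlongrightarrow> 1) at_top"
proof -
  have "((\<lambda>x. exp (- inverse x)) \<longlongrightarrow> exp (- 0 :: real)) at_top"
    by (intro tendsto_intros tendsto_inverse_0_at_top filterlim_ident)
  then have "((\<lambda>x. exp (- inverse x)) \<longlongrightarrow> (1 :: real)) at_top" by simp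
  then show ?thesis
    by (rule Lim_transform_eventually)
       (auto simp: flat_def inverse_eq_divide intro!: eventually_mono[OF eventually_gt_at_top[of 0]])
qed

text \<open>For positive \<open>y\<close> the argument tends to infinity, where
  \<open>flat 1\<close> approaches 1; otherwise it stays negative, where \<open>flat 1\<close> is
  0.\<close>

lemma flat_1_scaled_tendsto: "(\<lambda>n. flat 1 (real n * y - 1)) \<longlonglongrightarrow> (if y > 0 then 1 else 0)"
proof (cases "y > 0")
  case True
  have "filterlim (\<lambda>n. real n * y - 1) at_top sequentially"
    unfolding filterlim_at_top
  proof
    fix Z :: real
    show "\<forall>\<^sub>F n in sequentially. Z \<le> real n * y - 1"
    proof -
      obtain N :: nat where "(Z + 1) / y \<le> real N" using real_arch_simple by blast
      then have "Z + 1 \<le> real N * y" using True by (simp add: field_simps)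
      moreover have "real N * y \<le> real n * y" if "N \<le> n" for n
        using that True by simp
      ultimately show ?thesis
        by (intro eventually_sequentiallyI[of N]) (smt (verit))
    qed
  qed
  then show ?thesis
    using filterlim_compose[OF flat_1_tendsto_1] True by auto
next
  case False
  then have "flat 1 (real n * y - 1) = 0" for n
    using mult_nonneg_nonpos[of "real n" y] by (simp add: flat_def)
  then show ?thesis using False by simp
qed

lemma plateau_tendsto: "(\<lambda>n. plateau c d n x) \<longlonglongrightarrow> indicator {c<..<d} x"
proof -
  have "(\<lambda>n. plateau c d n x) \<longlonglongrightarrow> (if x - c > 0 then 1 else 0) * (if d - x > 0 then 1 else 0)"
    unfolding plateau_def by (intro tendsto_mult flat_1_scaled_tendsto)
  then show ?thesis by (auto simp: indicator_def split: if_splits)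
qed

section \<open>General properties of test functions\<close>

lemma test_fun_differentiable:
  assumes "\<eta> \<in> test_fun a b"
  shows "(\<eta> has_real_derivative deriv \<eta> x) (at x)" "continuous_on S \<eta>" "continuous_on S (deriv \<eta>)"
proof -
  have "(deriv ^^ n) \<eta> differentiable at x" for n x using assms by (auto simp: test_fun_def)
  from this[of 0] this[of 1] have d: "\<eta> differentiable at x" "deriv \<eta> differentiable at x" for x by auto
  show "(\<eta> has_real_derivative deriv \<eta> x) (at x)"
    using d by (metis DERIV_deriv_iff_real_differentiable)
  show "continuous_on S \<eta>" "continuous_on S (deriv \<eta>)"
    using d by (auto intro!: continuous_at_imp_continuous_on differentiable_imp_continuous_within)
qed

text \<open>Removes the boundary terms in integration by parts.\<close>

lemma test_fun_eq_0:
  assumes "\<eta> \<in> test_fun a b" "x \<notin> {a<..<b}"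
  shows "\<eta> x = 0"
  using assms closure_subset[of "{x. \<eta> x \<noteq> 0}"] unfolding test_fun_def by blast

text \<open>\<open>deriv\<close> is linear on differentiable functions, so the induction uses the
  smoothness of \<open>f\<close> and \<open>g\<close> at every order.\<close>

lemma smooth_linear_combination:
  fixes f g :: "real \<Rightarrow> real"
  assumes "\<And>n x. (deriv ^^ n) f differentiable at x" "\<And>n x. (deriv ^^ n) g differentiable at x"
  shows "(deriv ^^ n) (\<lambda>x. f x - k * g x) = (\<lambda>x. (deriv ^^ n) f x - k * (deriv ^^ n) g x)"
proof (induction n)
  case (Suc n)
  have "deriv (\<lambda>x. (deriv ^^ n) f x - k * (deriv ^^ n) g x) = (\<lambda>x. (deriv ^^ Suc n) f x - k * (deriv ^^ Suc n) g x)"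
  proof
    fix x
    have "((deriv ^^ n) f has_real_derivative (deriv ^^ Suc n) f x) (at x)"
      "((deriv ^^ n) g has_real_derivative (deriv ^^ Suc n) g x) (at x)"
      using assms[of n x] by (simp_all add: DERIV_deriv_iff_real_differentiable)
    then show "deriv (\<lambda>x. (deriv ^^ n) f x - k * (deriv ^^ n) g x) x
        = (deriv ^^ Suc n) f x - k * (deriv ^^ Suc n) g x"
      by (intro DERIV_imp_deriv) (auto intro!: derivative_eq_intros)
  qed
  then show ?case using Suc by simp
qed simp

lemma test_fun_diff_scaled:
  assumes f: "f \<in> test_fun a b" and g: "g \<in> test_fun a b"
  shows "(\<lambda>x. f x - k * g x) \<in> test_fun a b"
proof -
  have sm: "(deriv ^^ n) f differentiable at x" "(deriv ^^ n) g differentiable at x" for n x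
    using f g by (auto simp: test_fun_def)
  have "closure {x. f x - k * g x \<noteq> 0} \<subseteq> closure ({x. f x \<noteq> 0} \<union> {x. g x \<noteq> 0})"
    by (intro closure_mono) auto
  also have "\<dots> \<subseteq> {a<..<b}" using f g by (auto simp: test_fun_def)
  finally have "closure {x. f x - k * g x \<noteq> 0} \<subseteq> {a<..<b}" .
  then show ?thesis
    unfolding test_fun_def using sm
    by (simp add: smooth_linear_combination[OF sm] differentiable_diff)
qed

subsection \<open>The fundamental lemma of the calculus of variations\<close>

text \<open>A continuous function on a compact interval is bounded, so a multiple of
  \<open>g\<close> dominates the product.\<close>

lemma integrable_mult_continuous_on:
  fixes g h :: "real \<Rightarrow> real"
  assumes g: "integrable (lebesgue_on {a..b}) g" and h: "continuous_on {a..b} h"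
  shows "integrable (lebesgue_on {a..b}) (\<lambda>x. g x * h x)"
proof -
  have "compact (h ` {a..b})" by (intro compact_continuous_image h) simp
  then obtain K where K: "\<And>x. x \<in> {a..b} \<Longrightarrow> \<bar>h x\<bar> \<le> K"
    using compact_imp_bounded by (force simp: bounded_iff)
  show ?thesis
  proof (rule Bochner_Integration.integrable_bound)
    show "integrable (lebesgue_on {a..b}) (\<lambda>x. K * g x)" using g by simp
    show "(\<lambda>x. g x * h x) \<in> borel_measurable (lebesgue_on {a..b})"
      using g continuous_imp_measurable_on_sets_lebesgue[OF h] by simp
    show "AE x in lebesgue_on {a..b}. norm (g x * h x) \<le> norm (K * g x)"
    proof (rule AE_I2)
      fix x assume "x \<in> space (lebesgue_on {a..b})"
      then have "\<bar>h x\<bar> \<le> \<bar>K\<bar>" using K[of x] by simp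
      then show "norm (g x * h x) \<le> norm (K * g x)"
        by (simp add: abs_mult mult.commute[of "\<bar>K\<bar>"] mult_left_mono)
    qed
  qed
qed

text \<open>The Borel sets over which \<open>f\<close> integrates to 0 form a Dynkin system
  containing the closed intervals, hence are all Borel sets; and the integrals over Borel sets
  determine an integrable function almost everywhere.\<close>

lemma AE_lborel_eq_0_if_interval_integrals_0:
  fixes f :: "real \<Rightarrow> real"
  assumes f: "integrable lborel f" and int: "\<And>l u. l \<le> u \<Longrightarrow> (LINT x:{l..u}|lborel. f x) = 0"
  shows "AE x in lborel. f x = 0"
proof -
  have set_int: "set_integrable lborel A f" if "A \<in> sets borel" for A
    unfolding set_integrable_def using f that by (intro integrable_mult_indicator) auto
  \<comment> \<open>The complement case of the induction below needs the integral over the whole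
    line, obtained here as a limit over growing intervals.\<close>
  have "(\<lambda>n. LINT x:{- real n..real n}|lborel. f x) \<longlonglongrightarrow> (LINT x:UNIV|lborel. f x)"
    unfolding set_lebesgue_integral_def
  proof (rule integral_dominated_convergence)
    show "integrable lborel (\<lambda>x. \<bar>f x\<bar>)" using f by simp
    show "AE x in lborel. (\<lambda>n. indicat_real {- real n..real n} x *\<^sub>R f x) \<longlonglongrightarrow> indicat_real UNIV x *\<^sub>R f x"
    proof (rule AE_I2)
      fix x :: real
      obtain N :: nat where "\<bar>x\<bar> \<le> real N" using real_arch_simple by blast
      then have "eventually (\<lambda>n. indicat_real UNIV x *\<^sub>R f x = indicat_real {- real n..real n} x *\<^sub>R f x) sequentially"
        by (intro eventually_sequentiallyI[of N]) (auto simp: indicator_def)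
      then show "(\<lambda>n. indicat_real {- real n..real n} x *\<^sub>R f x) \<longlonglongrightarrow> indicat_real UNIV x *\<^sub>R f x"
        by (rule Lim_transform_eventually[OF tendsto_const])
    qed
  qed (use f in \<open>auto simp: indicator_def\<close>)
  then have UNIV: "(LINT x:UNIV|lborel. f x) = 0"
    using int by (simp add: LIMSEQ_const_iff)
  have "(LINT x:A|lborel. f x) = 0" if "A \<in> sets borel" for A
    using that
  proof (induction rule: borel_set_induct)
    case (compl A)
    then have "(LINT x:A \<union> - A|lborel. f x) = (LINT x:A|lborel. f x) + (LINT x:- A|lborel. f x)"
      by (intro set_integral_Un set_int) auto
    then show ?case using UNIV compl by simp
  next
    case (union F)
    have "(LINT x:(\<Union>i. F i)|lborel. f x) = (\<Sum>i. LINT x:F i|lborel. f x)"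
      using union.hyps by (intro lebesgue_integral_countable_add set_int) (auto simp: disjoint_family_on_def)
    then show ?case using union by simp
  qed (use int in \<open>auto simp: set_lebesgue_integral_def\<close>)
  then have "AE x in lborel. f x = (\<lambda>x. 0) x"
    using f by (intro density_unique_real) auto
  then show ?thesis by simp
qed

text \<open>The plateau functions are test functions, tend to the indicator and are bounded by 1, so
  dominated convergence applies with the absolute value of \<open>g\<close> as bound. The order of
  \<open>c\<close> and \<open>d\<close> is left open, so that a clipped interval may be
  empty.\<close>

lemma fundamental_lemma_interval:
  assumes g: "integrable (lebesgue_on {a..b}) g"
    and zero: "\<And>\<eta>. \<eta> \<in> test_fun a b \<Longrightarrow> (LINT x|lebesgue_on {a..b}. g x * \<eta> x) = 0"
    and cd: "a \<le> c" "d \<le> b"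
  shows "(LINT x|lebesgue_on {a..b}. g x * indicator {c<..<d} x) = 0"
proof -
  have cont: "continuous_on S (plateau c d n)" for S n
    using test_fun_differentiable(2)[OF plateau_in_test_fun[OF cd]] .
  have "(\<lambda>n. LINT x|lebesgue_on {a..b}. g x * plateau c d n x)
          \<longlonglongrightarrow> (LINT x|lebesgue_on {a..b}. g x * indicator {c<..<d} x)"
  proof (rule integral_dominated_convergence)
    show "integrable (lebesgue_on {a..b}) (\<lambda>x. \<bar>g x\<bar>)" using g by simp
    show "(\<lambda>x. g x * plateau c d n x) \<in> borel_measurable (lebesgue_on {a..b})" for n
      using integrable_mult_continuous_on[OF g cont] by auto
    then show "(\<lambda>x. g x * indicator {c<..<d} x) \<in> borel_measurable (lebesgue_on {a..b})"
      by (rule borel_measurable_LIMSEQ_real[where u = "\<lambda>n x. g x * plateau c d n x", rotated])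
         (intro tendsto_mult tendsto_const plateau_tendsto)
    show "AE x in lebesgue_on {a..b}. (\<lambda>n. g x * plateau c d n x) \<longlonglongrightarrow> g x * indicator {c<..<d} x"
      by (intro AE_I2 tendsto_mult tendsto_const plateau_tendsto)
    show "AE x in lebesgue_on {a..b}. norm (g x * plateau c d n x) \<le> \<bar>g x\<bar>" for n
      using plateau_bounds by (intro AE_I2) (simp add: abs_mult mult_left_le)
  qed
  then show ?thesis
    using zero plateau_in_test_fun[OF cd] by (simp add: LIMSEQ_const_iff)
qed

lemma AE_lebesgue_neq: "AE x in lebesgue. x \<noteq> (c :: real)"
  by (rule AE_completion[OF AE_lborel_singleton])

text \<open>Extended by 0, \<open>g\<close> integrates to 0 over every interval. The Dynkin argument
  is about \<open>lborel\<close>, hence the detour through a Borel function \<open>h\<close> that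
  agrees almost everywhere with the Lebesgue measurable extension.\<close>

lemma fundamental_lemma:
  assumes g: "integrable (lebesgue_on {a..b}) g"
    and zero: "\<And>\<eta>. \<eta> \<in> test_fun a b \<Longrightarrow> (LINT x|lebesgue_on {a..b}. g x * \<eta> x) = 0"
  shows "AE x in lebesgue_on {a..b}. g x = 0"
proof -
  define f where "f x = indicat_real {a..b} x * g x" for x
  have f: "integrable lebesgue f"
    using g by (simp add: f_def[abs_def] integrable_restrict_space)
  then obtain h where h: "h \<in> borel_measurable lborel" "AE x in lborel. f x = h x"
    using completion_ex_borel_measurable_real borel_measurable_integrable by blast
  have fh: "AE x in lebesgue. f x = h x" using h(2) by (rule AE_completion)
  have h': "h \<in> borel_measurable lebesgue" using h(1) by (rule measurable_completion)
  have "integrable lebesgue h" using f fh h' by (subst integrable_cong_AE[symmetric, of f]) auto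
  then have hint: "integrable lborel h" using h(1) by (simp add: integrable_completion)
  have "AE x in lborel. h x = 0"
  proof (rule AE_lborel_eq_0_if_interval_integrals_0[OF hint])
    fix l u :: real
    have m: "(\<lambda>x. indicat_real {l..u} x * h x) \<in> borel_measurable lborel" using h(1) by simp
    have "(LINT x:{l..u}|lborel. h x) = (LINT x|lebesgue. indicat_real {l..u} x * h x)"
      unfolding set_lebesgue_integral_def using m by (simp add: integral_completion)
    \<comment> \<open>Apart from the null set where \<open>f\<close> and \<open>h\<close> differ,
      the two integrands can differ only at \<open>a\<close>, \<open>b\<close>, \<open>l\<close> and
      \<open>u\<close>.\<close>
    also have "\<dots> = (LINT x|lebesgue. indicat_real {a..b} x * (g x * indicat_real {max l a<..<min u b} x))"
    proof (rule integral_cong_AE)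
      show "(\<lambda>x. indicat_real {l..u} x * h x) \<in> borel_measurable lebesgue"
        using m by (rule measurable_completion)
      have "(\<lambda>x. indicat_real {max l a<..<min u b} x) \<in> borel_measurable lebesgue"
        by (intro measurable_completion) simp
      then have "(\<lambda>x. f x * indicat_real {max l a<..<min u b} x) \<in> borel_measurable lebesgue"
        using borel_measurable_integrable[OF f] by (rule borel_measurable_times[rotated])
      then show "(\<lambda>x. indicat_real {a..b} x * (g x * indicat_real {max l a<..<min u b} x)) \<in> borel_measurable lebesgue"
        by (simp add: f_def[abs_def] mult.assoc)
      show "AE x in lebesgue. indicat_real {l..u} x * h x
              = indicat_real {a..b} x * (g x * indicat_real {max l a<..<min u b} x)"
        using fh AE_lebesgue_neq[of a] AE_lebesgue_neq[of b] AE_lebesgue_neq[of l] AE_lebesgue_neq[of u]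
        by eventually_elim (auto simp: f_def indicator_def)
    qed
    also have "\<dots> = (LINT x|lebesgue_on {a..b}. g x * indicator {max l a<..<min u b} x)"
      by (simp add: integral_restrict_space)
    also have "\<dots> = 0" using g zero by (rule fundamental_lemma_interval) auto
    finally show "(LINT x:{l..u}|lborel. h x) = 0" .
  qed
  then have "AE x in lebesgue. h x = 0" by (rule AE_completion)
  with fh have "AE x in lebesgue. x \<in> {a..b} \<longrightarrow> g x = 0"
    by eventually_elim (auto simp: f_def)
  then show ?thesis by (simp add: AE_restrict_space_iff)
qed

section \<open>Antiderivatives of test functions and the lemma of du Bois-Reymond\<close>

lemma LINT_lebesgue_on_eq_diff:
  assumes "\<And>x. (F has_real_derivative f x) (at x)" "a \<le> b" "continuous_on {a..b} f"
  shows "(LINT x|lebesgue_on {a..b}. f x) = F b - (F a :: real)"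
proof -
  \<comment> \<open>The fundamental theorem concerns the gauge integral; by continuity
    \<open>f\<close> is Lebesgue integrable, so both integrals agree.\<close>
  have "(f has_integral (F b - F a)) {a..b}"
    using assms by (intro fundamental_theorem_of_calculus)
      (auto simp: has_real_derivative_iff_has_vector_derivative has_vector_derivative_at_within)
  then show ?thesis
    using assms by (simp add: lebesgue_integral_eq_integral continuous_imp_integrable_real integral_unique)
qed

text \<open>An antiderivative is constant on intervals that miss the support of \<theta>. Normalised
  to vanish at \<open>a\<close>, it is 0 to the left of the support; its value at \<open>b\<close>,
  hence to the right, is the integral of \<theta>, which is 0.\<close>

lemma test_fun_antiderivative:
  assumes \<theta>: "\<theta> \<in> test_fun a b" and zero: "(LINT x|lebesgue_on {a..b}. \<theta> x) = 0" and "a < b"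
  obtains \<zeta> where "\<zeta> \<in> test_fun a b" "deriv \<zeta> = \<theta>"
proof -
  have cont: "continuous_on S \<theta>" for S using test_fun_differentiable(2)[OF \<theta>] .
  \<comment> \<open>The infinite bounds give one antiderivative on the whole line, where test
    functions live.\<close>
  have "\<exists>F. \<forall>x::real. - \<infinity> < ereal x \<longrightarrow> ereal x < \<infinity> \<longrightarrow> (F has_vector_derivative \<theta> x) (at x)"
    using cont[of UNIV] by (intro einterval_antiderivative) (auto simp: continuous_on_eq_continuous_at)
  then obtain F where F: "\<And>x. (F has_real_derivative \<theta> x) (at x)"
    by (auto simp: has_real_derivative_iff_has_vector_derivative)
  define S where "S = closure {x. \<theta> x \<noteq> 0}"
  have S: "S \<subseteq> {a<..<b}" "closed S" using \<theta> by (auto simp: S_def test_fun_def)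
  have \<theta>0: "\<theta> x = 0" if "x \<notin> S" for x using that closure_subset[of "{x. \<theta> x \<noteq> 0}"] by (auto simp: S_def)
  have "compact S" using S by (metis bounded_closed_interval bounded_subset compact_eq_bounded_closed
        greaterThanLessThan_subseteq_atLeastAtMost_iff order_refl subset_trans)
  \<comment> \<open>\<open>{l..r}\<close> is the hull of the support; if that is empty, the midpoint
    serves as a default.\<close>
  obtain l r where lr: "a < l" "r < b" "S \<subseteq> {l..r}" "l \<le> r"
  proof (cases "S = {}")
    case True
    show ?thesis by (rule that[of "(a+b)/2" "(a+b)/2"]) (use True \<open>a < b\<close> in auto)
  next
    case False
    obtain l where l: "l \<in> S" "\<And>x. x \<in> S \<Longrightarrow> l \<le> x" using compact_attains_inf[OF \<open>compact S\<close> False] by blast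
    obtain r where r: "r \<in> S" "\<And>x. x \<in> S \<Longrightarrow> x \<le> r" using compact_attains_sup[OF \<open>compact S\<close> False] by blast
    show ?thesis by (rule that[of l r]) (use l r S in auto)
  qed
  define \<zeta> where "\<zeta> x = F x - F a" for x
  have d\<zeta>: "(\<zeta> has_real_derivative \<theta> x) (at x)" for x
    unfolding \<zeta>_def using F[of x] by (auto intro!: derivative_eq_intros)
  then have deriv: "deriv \<zeta> = \<theta>" by (auto intro: DERIV_imp_deriv)
  have const: "\<zeta> x = \<zeta> y" if "x \<le> y" "\<And>z. x \<le> z \<Longrightarrow> z \<le> y \<Longrightarrow> z \<notin> S" for x y
  proof (cases "x = y")
    case False
    then show ?thesis
      using DERIV_isconst2[of x y \<zeta> y] d\<zeta> \<theta>0 that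
      by (metis DERIV_atLeastAtMost_imp_continuous_on less_eq_real_def order.refl)
  qed simp
  have \<zeta>a: "\<zeta> a = 0" by (simp add: \<zeta>_def)
  have \<zeta>b: "\<zeta> b = 0"
    using LINT_lebesgue_on_eq_diff[of F \<theta> a b] F zero cont \<open>a < b\<close> by (simp add: \<zeta>_def)
  have out: "\<zeta> x = 0" if "x \<notin> {l..r}" for x
  proof (cases "x < l")
    case True
    \<comment> \<open>\<open>const\<close> takes ordered points, so \<open>a\<close> and
      \<open>x\<close> are each compared with \<open>min a x\<close>; all three lie to the left of
      \<open>l\<close>.\<close>
    have "\<zeta> (min a x) = \<zeta> a" "\<zeta> (min a x) = \<zeta> x"
      by (rule const; use True lr in force)+
    then show ?thesis using \<zeta>a by simp
  next
    case False
    then have "x > r" using that by simp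
    have "\<zeta> b = \<zeta> (max b x)" "\<zeta> x = \<zeta> (max b x)"
      by (rule const; use \<open>x > r\<close> lr in force)+
    then show ?thesis using \<zeta>b by simp
  qed
  then have "{x. \<zeta> x \<noteq> 0} \<subseteq> {l..r}" by blast
  then have "closure {x. \<zeta> x \<noteq> 0} \<subseteq> {l..r}" by (intro closure_minimal) auto
  then have supp: "closure {x. \<zeta> x \<noteq> 0} \<subseteq> {a<..<b}" using lr by fastforce
  have "(deriv ^^ n) \<zeta> differentiable at x" for n x
  proof (cases n)
    case 0
    then show ?thesis using d\<zeta>[of x] by (auto intro: differentiableI has_field_derivative_imp_has_derivative)
  next
    case (Suc m)
    then have "(deriv ^^ n) \<zeta> = (deriv ^^ m) \<theta>"
      by (simp add: funpow_swap1 deriv)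
    then show ?thesis using \<theta> by (simp add: test_fun_def)
  qed
  with supp have "\<zeta> \<in> test_fun a b" by (simp add: test_fun_def)
  with deriv show ?thesis by (rule that[rotated])
qed

text \<open>Otherwise the fundamental lemma, applied to the constant 1, would give 1 = 0 almost
  everywhere on an interval of positive length.\<close>

lemma test_fun_nonzero_integral:
  assumes "a < b"
  obtains \<omega> where "\<omega> \<in> test_fun a b" "(LINT x|lebesgue_on {a..b}. \<omega> x) \<noteq> 0"
proof -
  have "\<not> (\<forall>\<eta>\<in>test_fun a b. (LINT x|lebesgue_on {a..b}. 1 * \<eta> x) = 0)"
  proof
    assume *: "\<forall>\<eta>\<in>test_fun a b. (LINT x|lebesgue_on {a..b}. 1 * \<eta> x) = 0"
    have "integrable (lebesgue_on {a..b}) (\<lambda>x. 1 :: real)"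
      by (intro continuous_imp_integrable_real continuous_intros)
    then have "AE x in lebesgue_on {a..b}. (1::real) = 0" using * by (intro fundamental_lemma) auto
    then have "AE x in lebesgue. x \<notin> {a..b}" by (simp add: AE_restrict_space_iff)
    then have "emeasure lebesgue {a..b} = 0"
      by (subst (asm) AE_iff_measurable[of "{a..b}"]) auto
    then show False using \<open>a < b\<close> by simp
  qed
  then show ?thesis using that by auto
qed

text \<open>Test functions with integral 0 are derivatives of test functions, so \<open>f\<close>
  annihilates them. Every test function becomes one of them after subtraction of a multiple of a
  fixed \<omega>; hence \<open>f\<close> acts on test functions as a constant does.\<close>

lemma du_Bois_Reymond:
  assumes "a < b" and f: "integrable (lebesgue_on {a..b}) f"
    and zero: "\<And>\<eta>. \<eta> \<in> test_fun a b \<Longrightarrow> (LINT x|lebesgue_on {a..b}. f x * deriv \<eta> x) = 0"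
  obtains c where "AE x in lebesgue_on {a..b}. f x = c"
proof -
  let ?I = "\<lambda>h. LINT x|lebesgue_on {a..b}. h x"
  obtain \<omega> where \<omega>: "\<omega> \<in> test_fun a b" "?I \<omega> \<noteq> 0"
    using test_fun_nonzero_integral[OF \<open>a < b\<close>] .
  \<comment> \<open>The value is forced: if \<open>f\<close> equals \<open>c\<close>, its integral
    against \<omega> is \<open>c\<close> times the integral of \<omega>.\<close>
  define c where "c = ?I (\<lambda>x. f x * \<omega> x) / ?I \<omega>"
  have int: "integrable (lebesgue_on {a..b}) \<eta>" "integrable (lebesgue_on {a..b}) (\<lambda>x. f x * \<eta> x)"
    if "\<eta> \<in> test_fun a b" for \<eta>
    using test_fun_differentiable(2)[OF that] f
    by (auto intro: continuous_imp_integrable_real integrable_mult_continuous_on)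
  have "AE x in lebesgue_on {a..b}. f x - c = 0"
  proof (rule fundamental_lemma)
    show "integrable (lebesgue_on {a..b}) (\<lambda>x. f x - c)"
      using continuous_imp_integrable_real[OF continuous_on_const] f
      by (intro Bochner_Integration.integrable_diff)
    fix \<eta> assume \<eta>: "\<eta> \<in> test_fun a b"
    \<comment> \<open>subtracting a multiple of \<open>\<omega>\<close> makes the integral vanish, so that the
      difference is the derivative of a test function\<close>
    define k where "k = ?I \<eta> / ?I \<omega>"
    have "?I (\<lambda>x. \<eta> x - k * \<omega> x) = 0"
      using int(1)[OF \<eta>] int(1)[OF \<omega>(1)] \<omega>(2) by (simp add: k_def)
    then obtain \<zeta> where \<zeta>: "\<zeta> \<in> test_fun a b" "deriv \<zeta> = (\<lambda>x. \<eta> x - k * \<omega> x)"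
      using test_fun_antiderivative[OF test_fun_diff_scaled[OF \<eta> \<omega>(1)] _ \<open>a < b\<close>] by blast
    have "0 = ?I (\<lambda>x. f x * \<eta> x - k * (f x * \<omega> x))"
      using zero[OF \<zeta>(1)] by (simp add: \<zeta>(2) algebra_simps)
    also have "\<dots> = ?I (\<lambda>x. f x * \<eta> x) - k * ?I (\<lambda>x. f x * \<omega> x)"
      using int(2)[OF \<eta>] int(2)[OF \<omega>(1)] by simp
    also have "\<dots> = ?I (\<lambda>x. f x * \<eta> x) - c * ?I \<eta>" by (simp add: k_def c_def)
    also have "\<dots> = ?I (\<lambda>x. (f x - c) * \<eta> x)"
      using int[OF \<eta>] by (simp add: left_diff_distrib)
    finally show "?I (\<lambda>x. (f x - c) * \<eta> x) = 0" by simp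
  qed
  then show ?thesis using that[of c] by simp
qed

subsection \<open>Weak derivatives\<close>

lemma test_fun_integrable:
  assumes "\<eta> \<in> test_fun a b" "integrable (lebesgue_on {a..b}) f"
  shows "integrable (lebesgue_on {a..b}) (\<lambda>x. f x * \<eta> x)"
    "integrable (lebesgue_on {a..b}) (\<lambda>x. f x * deriv \<eta> x)"
  using assms test_fun_differentiable(2,3) by (blast intro: integrable_mult_continuous_on)+

lemma has_weak_deriv_diff:
  assumes "has_weak_deriv a b f f'" "has_weak_deriv a b g g'"
  shows "has_weak_deriv a b (\<lambda>x. f x - g x) (\<lambda>x. f' x - g' x)"
  using assms unfolding has_weak_deriv_def
  by (auto simp: left_diff_distrib test_fun_integrable)

text \<open>Integration by parts, with test functions vanishing at both end points. Subtracting such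
  a line later turns a constant weak derivative into 0.\<close>

lemma has_weak_deriv_linear:
  assumes "a \<le> b"
  shows "has_weak_deriv a b (\<lambda>x. c * x) (\<lambda>x. c)"
proof -
  have lin: "integrable (lebesgue_on {a..b}) (\<lambda>x. c * x)"
    and const: "integrable (lebesgue_on {a..b}) (\<lambda>x. c)"
    by (intro continuous_imp_integrable_real continuous_intros)+
  have "(LINT x|lebesgue_on {a..b}. c * x * deriv \<eta> x) = - (LINT x|lebesgue_on {a..b}. c * \<eta> x)"
    if \<eta>: "\<eta> \<in> test_fun a b" for \<eta>
  proof -
    have "(LINT x|lebesgue_on {a..b}. c * x * deriv \<eta> x + c * \<eta> x) = c * b * \<eta> b - c * a * \<eta> a"
    proof (rule LINT_lebesgue_on_eq_diff[OF _ assms])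
      show "((\<lambda>x. c * x * \<eta> x) has_real_derivative c * x * deriv \<eta> x + c * \<eta> x) (at x)" for x
        using test_fun_differentiable(1)[OF \<eta>] by (auto intro!: derivative_eq_intros)
      show "continuous_on {a..b} (\<lambda>x. c * x * deriv \<eta> x + c * \<eta> x)"
        using test_fun_differentiable(2,3)[OF \<eta>] by (intro continuous_intros)
    qed
    then show ?thesis
      using test_fun_eq_0[OF \<eta>] test_fun_integrable[OF \<eta> lin] test_fun_integrable[OF \<eta> const] by simp
  qed
  then show ?thesis using lin const by (simp add: has_weak_deriv_def)
qed

text \<open>The difference of two weak derivatives integrates to 0 against every test function, so
  the fundamental lemma applies.\<close>

lemma has_weak_deriv_unique:
  assumes "has_weak_deriv a b f g" "has_weak_deriv a b f h"
  shows "AE x in lebesgue_on {a..b}. g x = h x"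
proof -
  have "AE x in lebesgue_on {a..b}. g x - h x = 0"
    using assms unfolding has_weak_deriv_def
    by (intro fundamental_lemma) (auto simp: left_diff_distrib test_fun_integrable)
  then show ?thesis by simp
qed

text \<open>\<open>weak_deriv\<close> is a choice, so it carries information only once some weak
  derivative is known to exist.\<close>

lemma has_weak_deriv_weak_deriv:
  assumes "has_weak_deriv a b f g"
  shows "has_weak_deriv a b f (weak_deriv a b f)"
  unfolding weak_deriv_def by (rule someI[of "has_weak_deriv a b f", OF assms])

lemma weak_deriv_AE_eq:
  assumes "has_weak_deriv a b f g"
  shows "AE x in lebesgue_on {a..b}. weak_deriv a b f x = g x"
  using has_weak_deriv_unique[OF has_weak_deriv_weak_deriv] assms by blast

text \<open>Only integrals of \<open>f\<close> enter the definition. This permits differentiating a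
  chosen representative once more.\<close>

lemma has_weak_deriv_cong_AE:
  assumes h: "has_weak_deriv a b f h" and g: "integrable (lebesgue_on {a..b}) g"
    and eq: "AE x in lebesgue_on {a..b}. f x = g x"
  shows "has_weak_deriv a b g h"
proof -
  have "(LINT x|lebesgue_on {a..b}. f x * deriv \<eta> x) = (LINT x|lebesgue_on {a..b}. g x * deriv \<eta> x)"
    if "\<eta> \<in> test_fun a b" for \<eta>
    using h g eq that by (intro integral_cong_AE) (auto simp: has_weak_deriv_def dest: test_fun_integrable(2))
  then show ?thesis using h g by (auto simp: has_weak_deriv_def)
qed

section \<open>Functions with vanishing or constant weak derivative\<close>

lemma weak_deriv_0_imp_AE_const:
  assumes "a < b" and h: "has_weak_deriv a b f g" and zero: "AE x in lebesgue_on {a..b}. g x = 0"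
  obtains c where "AE x in lebesgue_on {a..b}. f x = c"
proof (rule du_Bois_Reymond[OF \<open>a < b\<close>, of f])
  show "integrable (lebesgue_on {a..b}) f" using h by (simp add: has_weak_deriv_def)
  fix \<eta> assume \<eta>: "\<eta> \<in> test_fun a b"
  have "(LINT x|lebesgue_on {a..b}. g x * \<eta> x) = 0"
    using zero by (intro integral_eq_zero_AE) auto
  then show "(LINT x|lebesgue_on {a..b}. f x * deriv \<eta> x) = 0"
    using h \<eta> by (simp add: has_weak_deriv_def)
qed (use that in blast)

text \<open>A nonnegative continuous function with integral 0 vanishes everywhere. This upgrades an
  almost everywhere statement to a pointwise one, so that boundary values can be used.\<close>

lemma continuous_AE_eq_const:
  fixes f :: "real \<Rightarrow> real"
  assumes "a < b" and f: "continuous_on {a..b} f"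
    and eq: "AE x in lebesgue_on {a..b}. f x = c" and x: "x \<in> {a..b}"
  shows "f x = c"
proof -
  have "(LINT x|lebesgue_on {a..b}. \<bar>f x - c\<bar>) = 0"
    using eq by (intro integral_eq_zero_AE) auto
  then have "\<forall>x\<in>{a..b}. \<bar>f x - c\<bar> = 0"
    using f \<open>a < b\<close> by (subst (asm) integralL_eq_0_iff) (auto intro!: continuous_intros)
  then show ?thesis using x by simp
qed

text \<open>\<open>f x - c * x\<close> has weak derivative 0 and, by continuity, is constant on all
  of \<open>{a..b}\<close>; comparing the end points gives \<open>c * a = c * b\<close>.\<close>

lemma weak_deriv_const_Dirichlet:
  assumes "a < b" and h: "has_weak_deriv a b f g" and c: "AE x in lebesgue_on {a..b}. g x = c"
    and f: "continuous_on {a..b} f" "f a = 0" "f b = 0"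
  shows "c = 0"
proof -
  have "AE x in lebesgue_on {a..b}. g x - c = 0" using c by simp
  then obtain d where d: "AE x in lebesgue_on {a..b}. f x - c * x = d"
    using weak_deriv_0_imp_AE_const[OF \<open>a < b\<close> has_weak_deriv_diff[OF h has_weak_deriv_linear]] \<open>a < b\<close>
    by (metis less_eq_real_def)
  have "f x - c * x = d" if "x \<in> {a..b}" for x
    using f(1) by (intro continuous_AE_eq_const[OF \<open>a < b\<close> _ d that] continuous_intros)
  from this[of a] this[of b] have "- (c * a) = d" "- (c * b) = d" using f \<open>a < b\<close> by simp_all
  then have "c * a = c * b" by linarith
  then show ?thesis using \<open>a < b\<close> by simp
qed

section \<open>Sobolev functions and the Dirichlet problem\<close>

lemma sobolev_mono:
  assumes "p \<le> q"
  shows "sobolev q a b \<subseteq> sobolev p a b"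
  unfolding sobolev_def using assms by (blast intro: le_trans less_le_trans)

lemma sobolev_2_weak_derivs:
  assumes "u \<in> sobolev 2 a b"
  shows "has_weak_deriv a b u (weak_deriv a b u)"
    "has_weak_deriv a b (weak_deriv a b u) (weak_deriv a b (weak_deriv a b u))"
proof -
  obtain D where D: "D 0 = u" "\<forall>k<2. has_weak_deriv a b (D k) (D (Suc k))"
    using assms by (auto simp: sobolev_def)
  then have 1: "has_weak_deriv a b u (D 1)" and 2: "has_weak_deriv a b (D 1) (D 2)"
    by (auto simp: numeral_2_eq_2)
  show *: "has_weak_deriv a b u (weak_deriv a b u)" using 1 by (rule has_weak_deriv_weak_deriv)
  \<comment> \<open>The chosen representative agrees with \<open>D 1\<close> only almost everywhere,
    which is enough to inherit its weak derivative \<open>D 2\<close>.\<close>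
  then have "has_weak_deriv a b (weak_deriv a b u) (D 2)"
    using has_weak_deriv_unique[OF 1 *] by (intro has_weak_deriv_cong_AE[OF 2]) (auto simp: has_weak_deriv_def)
  then show "has_weak_deriv a b (weak_deriv a b u) (weak_deriv a b (weak_deriv a b u))"
    by (rule has_weak_deriv_weak_deriv)
qed

text \<open>The second weak derivatives agree almost everywhere, so the first ones differ by a
  constant, which the boundary values force to be 0. Uniqueness is stated for the first derivatives
  because \<open>G\<close> sees the solution only through them.\<close>

lemma T_D_eq_unique:
  assumes "a < b" and u: "u \<in> sobolev0 2 a b" "T_D_eq a b \<psi> u"
    and w: "w \<in> sobolev0 2 a b" "T_D_eq a b \<psi> w"
  shows "AE x in lebesgue_on {a..b}. weak_deriv a b u x = weak_deriv a b w x"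
proof -
  let ?W = "weak_deriv a b"
  have u': "has_weak_deriv a b u (?W u)" "has_weak_deriv a b (?W u) (?W (?W u))"
    and w': "has_weak_deriv a b w (?W w)" "has_weak_deriv a b (?W w) (?W (?W w))"
    using u w sobolev_2_weak_derivs by (auto simp: sobolev0_def)
  have "AE x in lebesgue_on {a..b}. ?W (?W u) x - ?W (?W w) x = 0"
    using u(2) w(2) unfolding T_D_eq_def by eventually_elim simp
  then obtain c where c: "AE x in lebesgue_on {a..b}. ?W u x - ?W w x = c"
    using weak_deriv_0_imp_AE_const[OF \<open>a < b\<close> has_weak_deriv_diff[OF u'(2) w'(2)]] by blast
  have "c = 0"
    using u w by (intro weak_deriv_const_Dirichlet[OF \<open>a < b\<close> has_weak_deriv_diff[OF u'(1) w'(1)] c])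
      (auto simp: sobolev0_def intro: continuous_intros)
  then show ?thesis using c by simp
qed

text \<open>The given \<open>u\<close> witnesses that the choice in \<open>u_sol\<close> has a
  candidate, so the chosen function solves the same problem and uniqueness applies.\<close>

lemma weak_deriv_u_sol:
  assumes "a < b" "u \<in> sobolev0 2 a b" "T_D_eq a b \<psi> u"
  shows "AE x in lebesgue_on {a..b}. weak_deriv a b (u_sol a b \<psi>) x = weak_deriv a b u x"
proof -
  have "u_sol a b \<psi> \<in> sobolev0 2 a b \<and> T_D_eq a b \<psi> (u_sol a b \<psi>)"
    unfolding u_sol_def by (rule someI[of _ u]) (use assms in blast)
  then show ?thesis using T_D_eq_unique assms by blast
qed

text \<open>Representatives are chosen separately for \<open>u\<close>, \<open>v\<close> and their
  difference, so \<open>weak_deriv\<close> is linear only almost everywhere; this suffices under the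
  integral.\<close>

lemma G_eq_L2_norm_weak_deriv_diff:
  assumes "a < b" and u: "u \<in> sobolev0 2 a b" "T_D_eq a b \<psi> u" and v: "v \<in> sobolev0 2 a b"
  shows "G a b v \<psi> = (L2_norm a b (weak_deriv a b (\<lambda>x. u x - v x)))\<^sup>2"
proof -
  have sol: "u_sol a b \<psi> \<in> sobolev0 2 a b"
    unfolding u_sol_def by (rule someI2[of _ u]) (use u in blast)+
  have W: "has_weak_deriv a b f (weak_deriv a b f)" if "f \<in> sobolev0 2 a b" for f
    using that sobolev_2_weak_derivs by (auto simp: sobolev0_def)
  note uv = has_weak_deriv_diff[OF W[OF u(1)] W[OF v]]
  have meas: "weak_deriv a b f \<in> borel_measurable (lebesgue_on {a..b})"
    if "has_weak_deriv a b f (weak_deriv a b f)" for f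
    using that by (auto simp: has_weak_deriv_def)
  have "(LINT x|lebesgue_on {a..b}. (weak_deriv a b (u_sol a b \<psi>) x - weak_deriv a b v x)\<^sup>2)
      = (LINT x|lebesgue_on {a..b}. (weak_deriv a b (\<lambda>x. u x - v x) x)\<^sup>2)"
  proof (rule integral_cong_AE)
    show "AE x in lebesgue_on {a..b}. (weak_deriv a b (u_sol a b \<psi>) x - weak_deriv a b v x)\<^sup>2
        = (weak_deriv a b (\<lambda>x. u x - v x) x)\<^sup>2"
      using weak_deriv_u_sol[OF assms(1-3)] weak_deriv_AE_eq[OF uv] by eventually_elim simp
  qed (use meas W sol v has_weak_deriv_weak_deriv[OF uv] in \<open>auto intro!: borel_measurable_power borel_measurable_diff\<close>)
  then show ?thesis by (simp add: G_def L2_norm_def)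
qed

lemma L2_norm_weak_deriv_le_H1_norm: "(L2_norm a b (weak_deriv a b f))\<^sup>2 \<le> (H1_norm a b f)\<^sup>2"
  by (simp add: H1_norm_def)

theorem theorem5p3:
  fixes a b :: real
  assumes "a < b"
  shows "\<exists>C::real. \<forall>\<delta>>0. \<forall>u\<in>sobolev0 3 a b. \<forall>v\<in>sobolev0 3 a b.
           \<forall>\<phi>\<in>L2 a b. \<forall>\<psi>\<in>L2 a b.
             H1_norm a b (\<lambda>x. u x - v x) \<le> \<delta> \<longrightarrow>
             T_D_eq a b \<phi> u \<longrightarrow> T_D_eq a b \<psi> v \<longrightarrow>
             G a b v \<psi> = 0 \<and> 0 \<le> G a b v \<phi> \<and> G a b v \<phi> \<le> C * \<delta>\<^sup>2"
proof (intro exI[of _ 1] allI ballI impI conjI)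
  fix \<delta> :: real and u v \<phi> \<psi>
  assume \<delta>: "0 < \<delta>" and "u \<in> sobolev0 3 a b" "v \<in> sobolev0 3 a b"
    and le: "H1_norm a b (\<lambda>x. u x - v x) \<le> \<delta>"
    and \<phi>: "T_D_eq a b \<phi> u" and \<psi>: "T_D_eq a b \<psi> v"
  then have u: "u \<in> sobolev0 2 a b" and v: "v \<in> sobolev0 2 a b"
    using sobolev_mono[of 2 3 a b] by (auto simp: sobolev0_def)
  \<comment> \<open>Here \<open>v\<close> itself solves the problem for \<psi>, so the integrand of
    \<open>G\<close> vanishes almost everywhere.\<close>
  have "AE x in lebesgue_on {a..b}. (weak_deriv a b (u_sol a b \<psi>) x - weak_deriv a b v x)\<^sup>2 = 0"
    using weak_deriv_u_sol[OF assms v \<psi>] by eventually_elim simp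
  then show "G a b v \<psi> = 0"
    by (simp add: G_def L2_norm_def integral_eq_zero_AE)
  show "0 \<le> G a b v \<phi>" by (simp add: G_def)
  have "(H1_norm a b (\<lambda>x. u x - v x))\<^sup>2 \<le> \<delta>\<^sup>2"
    using le by (intro power_mono) (simp_all add: H1_norm_def)
  then show "G a b v \<phi> \<le> 1 * \<delta>\<^sup>2"
    using L2_norm_weak_deriv_le_H1_norm[of a b "\<lambda>x. u x - v x"]
    by (simp add: G_eq_L2_norm_weak_deriv_diff[OF assms u \<phi> v])
qed

end
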